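(* Let $e$ be a regular expression over a finite alphabet $\Sigma$, let $\pi$ be a heap and $p$ an address with $\pi,p\models e$, with continuation function $\mathrm{cont}$ satisfying $\pi\models\mathrm{cont}$ (root $p$). Then for every string $w\in\Sigma^*$, there is a run of the PW$\pi$ machine \[ \langle p\,;\,w\rangle\to^{*}\langle\mathrm{null}\,;\,\epsilon_{\mathrm{str}}\rangle \] if and only if there is a finite run of the generic lockstep machine \[ \langle \{p\}\,;\,w\rangle \Rightarrow \cdots \Rightarrow \langle S\,;\,\epsilon_{\mathrm{str}}\rangle \] for some set of addresses $S$ with $\mathrm{null}\in S$.
   Context: Regular expressions over $\Sigma$: $e ::= \varepsilon \mid a \mid e^{*} \mid e_1e_2 \mid e_1\mid e_2$ ($a\in\Sigma$); $\varepsilon$ is a constant and $\epsilon_{\mathrm{str}}$ denotes the empty string. Heaps: a heap $\pi$ is a finite partial function from addresses to nodes; there is a distinguished address $\mathrm{null}$ not in its domain. A node is one of $a$ ($a\in\Sigma$), $\varepsilon$, $(p_1\mid p_2)$, $(p_1\bullet p_2)$, $(p_1)^{*}$ for addresses $p_1,p_2$. For partial functions with disjoint domains, $f_1\otimes f_2=f_1\cup f_2$. The relation $\pi,p\models e$ is defined by induction on $e$: $\pi,p\models a$ iff $\pi(p)=a$; $\pi,p\models\varepsilon$ iff $\pi(p)=\varepsilon$ (in these cases $\pi$ consists of the single cell at $p$); $\pi,p\models(e_1\mid e_2)$ iff $\pi=\pi_0\otimes\pi_1\otimes\pi_2$, $\pi_0(p)=(p_1\mid p_2)$, $\pi_1,p_1\models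 e_1$, $\pi_2,p_2\models e_2$; $\pi,p\models(e_1e_2)$ iff $\pi=\pi_0\otimes\pi_1\otimes\pi_2$, $\pi_0(p)=(p_1\bullet p_2)$, $\pi_1,p_1\models e_1$, $\pi_2,p_2\models e_2$; $\pi,p\models e_1^{*}$ iff $\pi=\pi_0\otimes\pi_1$, $\pi_0(p)=(p_1)^{*}$, $\pi_1,p_1\models e_1$. Continuation function: $\mathrm{cont}:\mathrm{dom}(\pi)\to\mathrm{dom}(\pi)\cup\{\mathrm{null}\}$ with $\pi\models\mathrm{cont}$ meaning: if $\pi(q)=(q_1\mid q_2)$ then $\mathrm{cont}(q_1)=\mathrm{cont}(q_2)=\mathrm{cont}(q)$; if $\pi(q)=(q_1\bullet q_2)$ then $\mathrm{cont}(q_1)=q_2$, $\mathrm{cont}(q_2)=\mathrm{cont}(q)$; if $\pi(q)=(q_1)^{*}$ then $\mathrm{cont}(q_1)=q$; and $\mathrm{cont}$ of the root is $\mathrm{null}$. Pointer steps relative to $\pi$: $q\to q_1$ and $q\to q_2$ if $\pi(q)=q_1\mid q_2$; $q\to q_1$ if $\pi(q)=q_1\bullet q_2$; $q\to q_1$ and $q\to\mathrm{cont}(q)$ if $\pi(q)=(q_1)^{*}$; $q\to\mathrm{cont}(q)$ if $\pi(q)=\varepsilon$; $q\xrightarrow{a}\mathrm{cont}(q)$ if $\pi(q)=a$. ($\mathrm{null}$ has no steps.) The PW$\pi$ machine has configurations $\langle q;w\rangle$ and transitions $\langle q;a\,w\rangle\to\langle q';w\rangle$ if $q\xrightarrow{a}q'$,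 and $\langle q;w\rangle\to\langle q';w\rangle$ if $q\to q'$; $\to^*$ is zero or more transitions. Evolution: for $S\subseteq\mathrm{dom}(\pi)\cup\{\mathrm{null}\}$, $\mathrm{evolve}(S)=\{q\in\mathrm{dom}(\pi)\cup\{\mathrm{null}\}\mid \exists p'\in S.\ p'\to^{*}q \text{ and } (q=\mathrm{null} \text{ or } \exists a.\ \pi(q)=a)\}$, where $\to^*$ is the reflexive–transitive closure of the unlabeled pointer step. Lockstep transitions on sets: $S\Rightarrow S'$ if $S'=\mathrm{evolve}(S)$; $S\xRightarrow{a}S'$ if $S'=\{q\in\mathrm{dom}(\pi)\cup\{\mathrm{null}\}\mid\exists p'\in S.\ p'\xrightarrow{a}q\}$. The generic lockstep machine has configurations $\langle S;w\rangle$ and transitions $\langle S;a\,w\rangle\Rightarrow\langle S';w\rangle$ if $S\xRightarrow{a}S'$, and $\langle S;w\rangle\Rightarrow\langle S';w\rangle$ if $S\Rightarrow S'$. *)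

theory Defs
  imports Main
begin

datatype (letters: 'a) regexp =
    Eps
  | Chr 'a
  | Star "'a regexp"
  | Seq "'a regexp" "'a regexp"
  | Alt "'a regexp" "'a regexp"

datatype (node_letters: 'a, node_addrs: 'p) node =
    NChr 'a
  | NEps
  | NAlt 'p 'p
  | NSeq 'p 'p
  | NStar 'p

type_synonym ('a, 'p) heap = "'p \<rightharpoonup> ('a, 'p) node"

definition is_heap :: "'a set \<Rightarrow> 'p \<Rightarrow> ('a, 'p) heap \<Rightarrow> bool" where
  "is_heap \<Sigma> null \<pi> \<longleftrightarrow>
     finite (dom \<pi>) \<and> null \<notin> dom \<pi> \<and> (\<forall>n\<in>ran \<pi>. node_letters n \<subseteq> \<Sigma>)"

text \<open>The partial operation \<open>f\<^sub>1 \<otimes> f\<^sub>2\<close> is rendered as \<^term>\<open>f\<^sub>1 ++ f\<^sub>2\<close>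
  together with the side condition that the domains are disjoint.\<close>

definition orth :: "('p \<rightharpoonup> 'b) \<Rightarrow> ('p \<rightharpoonup> 'b) \<Rightarrow> bool" where
  "orth f g \<longleftrightarrow> dom f \<inter> dom g = {}"

text \<open>In the composite cases \<open>\<pi>\<^sub>0\<close> is only required to hold the right node at \<open>p\<close>;
  it may contain further cells.\<close>

fun models :: "('a, 'p) heap \<Rightarrow> 'p \<Rightarrow> 'a regexp \<Rightarrow> bool" where
  "models \<pi> p (Chr a) \<longleftrightarrow> \<pi> = [p \<mapsto> NChr a]"
| "models \<pi> p Eps \<longleftrightarrow> \<pi> = [p \<mapsto> NEps]"
| "models \<pi> p (Alt e1 e2) \<longleftrightarrow>
     (\<exists>\<pi>0 \<pi>1 \<pi>2 p1 p2. orth \<pi>0 \<pi>1 \<and> orth (\<pi>0 ++ \<pi>1) \<pi>2 \<and> \<pi> = \<pi>0 ++ \<pi>1 ++ \<pi>2 \<and>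
        \<pi>0 p = Some (NAlt p1 p2) \<and> models \<pi>1 p1 e1 \<and> models \<pi>2 p2 e2)"
| "models \<pi> p (Seq e1 e2) \<longleftrightarrow>
     (\<exists>\<pi>0 \<pi>1 \<pi>2 p1 p2. orth \<pi>0 \<pi>1 \<and> orth (\<pi>0 ++ \<pi>1) \<pi>2 \<and> \<pi> = \<pi>0 ++ \<pi>1 ++ \<pi>2 \<and>
        \<pi>0 p = Some (NSeq p1 p2) \<and> models \<pi>1 p1 e1 \<and> models \<pi>2 p2 e2)"
| "models \<pi> p (Star e1) \<longleftrightarrow>
     (\<exists>\<pi>0 \<pi>1 p1. orth \<pi>0 \<pi>1 \<and> \<pi> = \<pi>0 ++ \<pi>1 \<and>
        \<pi>0 p = Some (NStar p1) \<and> models \<pi>1 p1 e1)"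

text \<open>Continuation functions are total in HOL; only their values on \<^term>\<open>dom \<pi>\<close> are used
  by the steps below. The address \<open>p\<close> is the root.\<close>

definition models_cont ::
  "'p \<Rightarrow> ('a, 'p) heap \<Rightarrow> 'p \<Rightarrow> ('p \<Rightarrow> 'p) \<Rightarrow> bool" where
  "models_cont null \<pi> p cont \<longleftrightarrow>
     (\<forall>q\<in>dom \<pi>. cont q \<in> dom \<pi> \<union> {null}) \<and>
     (\<forall>q q1 q2. \<pi> q = Some (NAlt q1 q2) \<longrightarrow> cont q1 = cont q \<and> cont q2 = cont q) \<and>
     (\<forall>q q1 q2. \<pi> q = Some (NSeq q1 q2) \<longrightarrow> cont q1 = q2 \<and> cont q2 = cont q) \<and>
     (\<forall>q q1. \<pi> q = Some (NStar q1) \<longrightarrow> cont q1 = q) \<and>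
     cont p = null"

inductive eps_step :: "('a, 'p) heap \<Rightarrow> ('p \<Rightarrow> 'p) \<Rightarrow> 'p \<Rightarrow> 'p \<Rightarrow> bool"
  for \<pi> :: "('a, 'p) heap" and cont :: "'p \<Rightarrow> 'p" where
  alt_left: "\<pi> q = Some (NAlt q1 q2) \<Longrightarrow> eps_step \<pi> cont q q1"
| alt_right: "\<pi> q = Some (NAlt q1 q2) \<Longrightarrow> eps_step \<pi> cont q q2"
| seq: "\<pi> q = Some (NSeq q1 q2) \<Longrightarrow> eps_step \<pi> cont q q1"
| star_body: "\<pi> q = Some (NStar q1) \<Longrightarrow> eps_step \<pi> cont q q1"
| star_exit: "\<pi> q = Some (NStar q1) \<Longrightarrow> eps_step \<pi> cont q (cont q)"
| eps: "\<pi> q = Some NEps \<Longrightarrow> eps_step \<pi> cont q (cont q)"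

inductive chr_step :: "('a, 'p) heap \<Rightarrow> ('p \<Rightarrow> 'p) \<Rightarrow> 'a \<Rightarrow> 'p \<Rightarrow> 'p \<Rightarrow> bool"
  for \<pi> :: "('a, 'p) heap" and cont :: "'p \<Rightarrow> 'p" where
  chr: "\<pi> q = Some (NChr a) \<Longrightarrow> chr_step \<pi> cont a q (cont q)"

inductive pw_step ::
  "('a, 'p) heap \<Rightarrow> ('p \<Rightarrow> 'p) \<Rightarrow> 'p \<times> 'a list \<Rightarrow> 'p \<times> 'a list \<Rightarrow> bool"
  for \<pi> :: "('a, 'p) heap" and cont :: "'p \<Rightarrow> 'p" where
  pw_chr: "chr_step \<pi> cont a q q' \<Longrightarrow> pw_step \<pi> cont (q, a # w) (q', w)"
| pw_eps: "eps_step \<pi> cont q q' \<Longrightarrow> pw_step \<pi> cont (q, w) (q', w)"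

definition evolve :: "'p \<Rightarrow> ('a, 'p) heap \<Rightarrow> ('p \<Rightarrow> 'p) \<Rightarrow> 'p set \<Rightarrow> 'p set" where
  "evolve null \<pi> cont S =
     {q \<in> dom \<pi> \<union> {null}.
        \<exists>p'\<in>S. (eps_step \<pi> cont)\<^sup>*\<^sup>* p' q \<and> (q = null \<or> (\<exists>a. \<pi> q = Some (NChr a)))}"

definition chr_image :: "'p \<Rightarrow> ('a, 'p) heap \<Rightarrow> ('p \<Rightarrow> 'p) \<Rightarrow> 'a \<Rightarrow> 'p set \<Rightarrow> 'p set" where
  "chr_image null \<pi> cont a S = {q \<in> dom \<pi> \<union> {null}. \<exists>p'\<in>S. chr_step \<pi> cont a p' q}"

inductive lockstep ::
  "'p \<Rightarrow> ('a, 'p) heap \<Rightarrow> ('p \<Rightarrow> 'p) \<Rightarrow> 'p set \<times> 'a list \<Rightarrow> 'p set \<times> 'a list \<Rightarrow> bool"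
  for null :: 'p and \<pi> :: "('a, 'p) heap" and cont :: "'p \<Rightarrow> 'p" where
  lock_chr: "S' = chr_image null \<pi> cont a S \<Longrightarrow> lockstep null \<pi> cont (S, a # w) (S', w)"
| lock_eps: "S' = evolve null \<pi> cont S \<Longrightarrow> lockstep null \<pi> cont (S, w) (S', w)"

end

theory Submission
  imports Defs
begin

text \<open>Backwards, every address in a lockstep set is reached by an individual run of the PW machine
  from some address in the initial set. Forwards, a PW run is cut at its letter steps: the
  unlabeled steps before a letter, or before the final null, are absorbed into one evolution,
  because the address that reads the letter is itself a letter node and so survives the evolution.\<close>

lemma eps_steps_imp_pw_steps:
  assumes "(eps_step \<pi> cont)\<^sup>*\<^sup>* q q'"
  shows "(pw_step \<pi> cont)\<^sup>*\<^sup>* (q, w) (q', w)"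
  using assms
proof (induction rule: rtranclp_induct)
  case (step q' q'')
  from step.IH pw_eps[OF step.hyps(2)] show ?case
    by (rule rtranclp.rtrancl_into_rtrancl)
qed simp

text \<open>A letter transition traces back to one PW step, but an evolution to an unlabeled path of
  any length, possibly zero; hence the closure in the conclusion.\<close>

lemma lockstep_imp_pw_steps:
  assumes "lockstep null \<pi> cont (S, w) (S', w')" and "q' \<in> S'"
  shows "\<exists>q\<in>S. (pw_step \<pi> cont)\<^sup>*\<^sup>* (q, w) (q', w')"
  using assms(1)
proof cases
  case (lock_chr a)
  with assms(2) show ?thesis
    unfolding chr_image_def by (auto dest!: pw_chr)
next
  case lock_eps
  with assms(2) show ?thesis
    unfolding evolve_def by (auto intro: eps_steps_imp_pw_steps)
qed

text \<open>Transitions are peeled off the front: the PW run found for the remainder starts inside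
  the intermediate set, so its source can be traced back once more.\<close>

lemma lockstep_run_imp_pw_run:
  assumes "(lockstep null \<pi> cont)\<^sup>*\<^sup>* (S, w) (S', w')" and "q' \<in> S'"
  shows "\<exists>q\<in>S. (pw_step \<pi> cont)\<^sup>*\<^sup>* (q, w) (q', w')"
  using assms
proof (induction "(S, w)" arbitrary: S w rule: converse_rtranclp_induct)
  case base
  then show ?case by blast
next
  case (step c)
  obtain T v where c: "c = (T, v)" by fastforce
  from step c obtain r where r: "r \<in> T" "(pw_step \<pi> cont)\<^sup>*\<^sup>* (r, v) (q', w')"
    by blast
  from lockstep_imp_pw_steps[OF step.hyps(1)[unfolded c] r(1)]
  obtain q where "q \<in> S" "(pw_step \<pi> cont)\<^sup>*\<^sup>* (q, w) (r, v)" by blast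
  with rtranclp_trans[OF _ r(2)] show ?case by blast
qed

text \<open>The invariant lets \<open>q\<close> lag outside \<open>S\<close>, asking only for an
  unlabeled path from some \<open>s\<close> in \<open>S\<close>. Unlabeled PW steps are thus
  collected without moving the lockstep machine.\<close>

lemma pw_run_imp_lockstep_run:
  assumes "(pw_step \<pi> cont)\<^sup>*\<^sup>* (q, w) (null, [])"
    and "\<forall>q\<in>dom \<pi>. cont q \<in> dom \<pi> \<union> {null}"
    and "s \<in> S" and "(eps_step \<pi> cont)\<^sup>*\<^sup>* s q"
  shows "\<exists>S'. (lockstep null \<pi> cont)\<^sup>*\<^sup>* (S, w) (S', []) \<and> null \<in> S'"
  using assms(1,3,4)
proof (induction "(q, w)" arbitrary: q w s S rule: converse_rtranclp_induct)
  case base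
  then have "null \<in> evolve null \<pi> cont S"
    unfolding evolve_def by blast
  moreover have "(lockstep null \<pi> cont)\<^sup>*\<^sup>* (S, []) (evolve null \<pi> cont S, [])"
    by (rule r_into_rtranclp) (rule lock_eps[OF refl])
  ultimately show ?case by blast
next
  case (step c)
  from step.hyps(1) show ?case
  proof cases
    case (pw_chr a q' v)
    then have node: "\<pi> q = Some (NChr a)" and q': "q' = cont q"
      by (auto elim: chr_step.cases)
    let ?T = "evolve null \<pi> cont S"
    let ?U = "chr_image null \<pi> cont a ?T"
    have "q \<in> ?T"
      using step.prems node unfolding evolve_def by blast
    \<comment> \<open>\<open>chr_image\<close> keeps only such addresses, so the range condition on
      \<open>cont\<close> enters here.\<close>
    moreover have "q' \<in> dom \<pi> \<union> {null}"
      using assms(2) node q' by blast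
    ultimately have "q' \<in> ?U"
      using pw_chr unfolding chr_image_def by blast
    \<comment> \<open>The collected path restarts as the empty one, with \<open>q'\<close> itself as
      the new \<open>s\<close>.\<close>
    then obtain S' where S': "(lockstep null \<pi> cont)\<^sup>*\<^sup>* (?U, v) (S', [])" "null \<in> S'"
      using step.hyps(3)[OF pw_chr(2)] by blast
    have "lockstep null \<pi> cont (S, w) (?T, w)"
      by (simp add: lock_eps)
    moreover have "lockstep null \<pi> cont (?T, w) (?U, v)"
      using pw_chr by (simp add: lock_chr)
    ultimately have "(lockstep null \<pi> cont)\<^sup>*\<^sup>* (S, w) (S', [])"
      using S'(1) by (rule converse_rtranclp_into_rtranclp[OF _ converse_rtranclp_into_rtranclp])
    with S'(2) show ?thesis by blast
  next
    case (pw_eps q')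
    \<comment> \<open>The lockstep machine stays at \<open>S\<close>; only the pending path
      grows.\<close>
    then have "(eps_step \<pi> cont)\<^sup>*\<^sup>* s q'"
      using step.prems(2) by simp
    then show ?thesis
      using step.hyps(3)[OF pw_eps(1)] step.prems(1) by blast
  qed
qed

theorem theorem3:
  fixes \<Sigma> :: "'a set" and e :: "'a regexp" and null p :: 'p
    and \<pi> :: "('a, 'p) heap" and cont :: "'p \<Rightarrow> 'p" and w :: "'a list"
  assumes "finite \<Sigma>"
    and "letters e \<subseteq> \<Sigma>"
    and "is_heap \<Sigma> null \<pi>"
    and "models \<pi> p e"
    and "models_cont null \<pi> p cont"
    and "w \<in> lists \<Sigma>"
  shows "(pw_step \<pi> cont)\<^sup>*\<^sup>* (p, w) (null, []) \<longleftrightarrow>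
         (\<exists>S. (lockstep null \<pi> cont)\<^sup>*\<^sup>* ({p}, w) (S, []) \<and> null \<in> S)"
proof
  assume "(pw_step \<pi> cont)\<^sup>*\<^sup>* (p, w) (null, [])"
  moreover have "\<forall>q\<in>dom \<pi>. cont q \<in> dom \<pi> \<union> {null}"
    using assms(5) unfolding models_cont_def by blast
  ultimately show "\<exists>S. (lockstep null \<pi> cont)\<^sup>*\<^sup>* ({p}, w) (S, []) \<and> null \<in> S"
    by (rule pw_run_imp_lockstep_run) auto
next
  assume "\<exists>S. (lockstep null \<pi> cont)\<^sup>*\<^sup>* ({p}, w) (S, []) \<and> null \<in> S"
  then show "(pw_step \<pi> cont)\<^sup>*\<^sup>* (p, w) (null, [])"
    \<comment> \<open>The initial set is a singleton, so the source of the PW run must be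
      \<open>p\<close>.\<close>
    by (auto dest: lockstep_run_imp_pw_run)
qed

end
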